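(* Let $G$ be a finite group (written multiplicatively) and let $H=\{H_1,\dots,H_m\}$ be a collection of distinct subgroups of $G$ such that $G=H_iH_j$ for all $1\le i\ne j\le m$. Then: (i) $H$ is a non-disjoint $(|G|,m,|H_1|,\dots,|H_m|)$-GPSEDF with $\lambda_{i,j}=|H_i\cap H_j|$ for all $i\ne j$. (ii) For any $i$, replacing $H_i$ in $H$ by a union of $\mu_i$ distinct left cosets $gH_i$ of $H_i$ yields a non-disjoint $(|G|,m,|H_1|,\dots,\mu_i|H_i|,\dots,|H_m|)$-GPSEDF.
   Context: $H_iH_j=\{xy:x\in H_i,y\in H_j\}$. For subsets $A,B$ of a multiplicatively written group $G$, $\Delta(A,B)$ denotes the multiset $\{ab^{-1}:a\in A,b\in B\}$ (one entry per pair). For $\lambda\in\mathbb{N}\cup\{0\}$, $\lambda G$ is the multiset containing every element of $G$ exactly $\lambda$ times. Let $|G|=v$. A family of sets $\{A_1,\dots,A_m\}$ in $G$ with $|A_i|=k_i$ is a non-disjoint $(v,m,k_1,\dots,k_m)$-GPSEDF if $\Delta(A_i,A_j)=\lambda_{i,j}G$ with $\lambda_{i,j}=k_ik_j/v$ for all $1\le i\ne j\le m$. *)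

theory Defs
  imports Complex_Main "HOL-Library.Multiset" "HOL-Algebra.Coset" "HOL-Algebra.Left_Coset"
begin

(* The multiset of quotients: one entry a b^{-1} for each pair (a, b) in A x B.
   Pitfall: mset_set is empty on infinite sets, so this is meaningful for finite A, B only. *)
definition Delta :: "('a, 'b) monoid_scheme \<Rightarrow> 'a set \<Rightarrow> 'a set \<Rightarrow> 'a multiset" where
  "Delta G A B = image_mset (\<lambda>(a, b). a \<otimes>\<^bsub>G\<^esub> inv\<^bsub>G\<^esub> b) (mset_set (A \<times> B))"

definition mult_carrier :: "nat \<Rightarrow> ('a, 'b) monoid_scheme \<Rightarrow> 'a multiset" where
  "mult_carrier l G = repeat_mset l (mset_set (carrier G))"

(* The sets A 1, ..., A m form a non-disjoint (v, m, k 1, ..., k m)-GPSEDF in G with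
   multiplicities l i j.  "Non-disjoint" means that disjointness is not required.
   The family is indexed, so its members may coincide as sets.
   Values of A, k, l at indices outside {1..m} are irrelevant, as are l i i. *)
definition nondisjoint_GPSEDF_with ::
  "('a, 'b) monoid_scheme \<Rightarrow> nat \<Rightarrow> nat \<Rightarrow> (nat \<Rightarrow> nat) \<Rightarrow> (nat \<Rightarrow> nat \<Rightarrow> nat) \<Rightarrow> (nat \<Rightarrow> 'a set) \<Rightarrow> bool"
where
  "nondisjoint_GPSEDF_with G v m k l A \<longleftrightarrow>
     group G \<and> finite (carrier G) \<and> order G = v \<and>
     (\<forall>i\<in>{1..m}. A i \<subseteq> carrier G \<and> card (A i) = k i) \<and>
     (\<forall>i\<in>{1..m}. \<forall>j\<in>{1..m}. i \<noteq> j \<longrightarrow>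
        real (l i j) = real (k i) * real (k j) / real v \<and>
        Delta G (A i) (A j) = mult_carrier (l i j) G)"

definition nondisjoint_GPSEDF ::
  "('a, 'b) monoid_scheme \<Rightarrow> nat \<Rightarrow> nat \<Rightarrow> (nat \<Rightarrow> nat) \<Rightarrow> (nat \<Rightarrow> 'a set) \<Rightarrow> bool"
where
  "nondisjoint_GPSEDF G v m k A \<longleftrightarrow> (\<exists>l. nondisjoint_GPSEDF_with G v m k l A)"

end

theory Submission
  imports Defs
begin

text \<open>
  If \<open>K\<close> is a subgroup, then the multiplicity of \<open>x\<close> in the quotients of \<open>A\<close> by \<open>K\<close> is
  \<open>card (A \<inter> xK)\<close>. If moreover \<open>G = HK\<close>, then \<open>g\<^sup>-\<^sup>1 x = hk\<close> for some \<open>h \<in> H\<close> and \<open>k \<in> K\<close>,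
  so with \<open>y = gh\<close> the cosets \<open>gH = yH\<close> and \<open>xK = yK\<close> meet in \<open>y(H \<inter> K)\<close>. Hence a union of
  \<open>\<mu>\<close> left cosets of \<open>H\<close> meets every coset \<open>xK\<close> in exactly \<open>\<mu> card (H \<inter> K)\<close> elements.
  Interchanging the two sets inverts all quotients, and the formula for the multiplicities follows by
  counting pairs.
\<close>

no_notation subset_mset (infix \<open><#\<close> 50)

context group
begin

text \<open>For fixed \<open>x\<close>, the equation \<open>x = a \<otimes> inv b\<close> says
  \<open>a = x \<otimes> b\<close>. So \<open>a\<close> determines \<open>b\<close>, and a suitable
  \<open>b\<close> in \<open>K\<close> exists exactly when \<open>a\<close> lies in
  \<open>x <# K\<close>; counting pairs becomes counting such \<open>a\<close>.\<close>

lemma count_Delta_subgroup: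
  assumes "finite (carrier G)" "A \<subseteq> carrier G" "subgroup K G" "x \<in> carrier G"
  shows "count (Delta G A K) x = card (A \<inter> (x <# K))"
proof -
  interpret K: subgroup K G by fact
  let ?P = "{p. p \<in> A \<times> K \<and> x = (case p of (a, b) \<Rightarrow> a \<otimes> inv b)}"
  have fin: "finite (A \<times> K)"
    using assms finite_subset K.subset by blast
  have "count (Delta G A K) x = (\<Sum>p\<in>?P. count (mset_set (A \<times> K)) p)"
    unfolding Delta_def count_image_mset' using fin by simp
  also have "\<dots> = card ?P"
    using fin by simp
  also have "\<dots> = card (A \<inter> (x <# K))"
  proof (rule bij_betw_same_card[of fst])
    have eq: "x = a \<otimes> inv b \<longleftrightarrow> a = x \<otimes> b" if "a \<in> A" "b \<in> K" for a b
      using that assms by (metis K.mem_carrier inv_solve_right subsetD)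
    have "inj_on fst ?P"
    proof (rule inj_onI)
      fix p q assume "p \<in> ?P" "q \<in> ?P" "fst p = fst q"
      then obtain a b c where p: "p = (a, b)" and q: "q = (a, c)"
        and abc: "a \<in> A" "b \<in> K" "c \<in> K" "x = a \<otimes> inv b" "x = a \<otimes> inv c"
        by (cases p; cases q) simp
      then have "x \<otimes> b = x \<otimes> c"
        using eq by metis
      then show "p = q"
        using p q abc(2,3) assms(4) by simp
    qed
    moreover have "fst ` ?P = A \<inter> (x <# K)"
    proof (intro equalityI subsetI)
      fix a assume "a \<in> fst ` ?P"
      then obtain b where "a \<in> A" "b \<in> K" "x = a \<otimes> inv b"
        by auto
      then show "a \<in> A \<inter> (x <# K)"
        using eq[of a b] unfolding l_coset_def by blast
    next
      fix a assume "a \<in> A \<inter> (x <# K)"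
      then obtain b where ab: "a \<in> A" "b \<in> K" "a = x \<otimes> b"
        unfolding l_coset_def by blast
      then have "x = a \<otimes> inv b"
        using eq by blast
      with ab(1,2) have "(a, b) \<in> ?P"
        by simp
      then show "a \<in> fst ` ?P"
        by (rule rev_image_eqI) simp
    qed
    ultimately show "bij_betw fst ?P (A \<inter> (x <# K))"
      by (simp add: bij_betw_def)
  qed
  finally show ?thesis .
qed

text \<open>Cancellation on the left: a common element \<open>y \<otimes> a = y \<otimes> b\<close>
  forces \<open>a = b\<close>.\<close>

lemma l_coset_Int:
  assumes "y \<in> carrier G" "A \<subseteq> carrier G" "B \<subseteq> carrier G"
  shows "y <# (A \<inter> B) = (y <# A) \<inter> (y <# B)"
  using assms by (auto simp: l_coset_def subset_iff)

lemma card_l_coset: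
  assumes "y \<in> carrier G" "A \<subseteq> carrier G"
  shows "card (y <# A) = card A"
proof -
  have "y <# A = (\<otimes>) y ` A"
    by (auto simp: l_coset_def)
  then show ?thesis
    using assms inj_on_g' by (simp add: card_image)
qed

lemma card_Int_l_cosets:
  assumes "subgroup H G" "subgroup K G" "carrier G = H <#> K"
    and "g \<in> carrier G" "x \<in> carrier G"
  shows "card ((g <# H) \<inter> (x <# K)) = card (H \<inter> K)"
proof -
  interpret H: subgroup H G by fact
  interpret K: subgroup K G by fact
  \<comment> \<open>Here \<open>carrier G = H <#> K\<close> enters: the factors of
    \<open>inv g \<otimes> x\<close> supply a representative shared by both cosets.\<close>
  have "inv g \<otimes> x \<in> H <#> K"
    using assms by auto
  then obtain h k where hk: "h \<in> H" "k \<in> K" "inv g \<otimes> x = h \<otimes> k"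
    by (auto simp: set_mult_def)
  then have x: "x = g \<otimes> h \<otimes> k"
    using assms by (metis H.mem_carrier K.mem_carrier inv_solve_left m_assoc m_closed)
  define y where "y = g \<otimes> h"
  have y: "y \<in> carrier G"
    using assms(4) hk(1) by (simp add: y_def)
  \<comment> \<open>The second membership holds because \<open>x = y \<otimes> k\<close>.\<close>
  have "y \<in> g <# H" "x \<in> y <# K"
    using hk x by (auto simp: y_def l_coset_def)
  then have "g <# H = y <# H" "x <# K = y <# K"
    using assms y l_repr_independence by metis+
  then show ?thesis
    using y card_l_coset[of y "H \<inter> K"] by (simp add: l_coset_Int H.subset K.subset le_infI1)
qed

text \<open>Distinct left cosets of \<open>H\<close> are disjoint, so their intersections with
  \<open>x <# K\<close>, all of the same size, add up.\<close>

lemma Delta_Union_lcosets: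
  assumes fin: "finite (carrier G)"
    and HK: "subgroup H G" "subgroup K G" "carrier G = H <#> K"
    and C: "C \<subseteq> lcosets H"
  shows "Delta G (\<Union>C) K = mult_carrier (card C * card (H \<inter> K)) G"
proof (rule multiset_eqI)
  fix x
  have sub: "\<Union>C \<subseteq> carrier G"
    using C lcosets_part_G[OF HK(1)] by blast
  have finC: "finite C"
    by (rule finite_UnionD[OF finite_subset[OF sub fin]])
  show "count (Delta G (\<Union>C) K) x = count (mult_carrier (card C * card (H \<inter> K)) G) x"
  proof (cases "x \<in> carrier G")
    case True
    have "card (\<Union>C \<inter> (x <# K)) = card (\<Union>A\<in>C. A \<inter> (x <# K))"
      by (rule arg_cong[OF Int_Union2])
    also have "\<dots> = (\<Sum>A\<in>C. card (A \<inter> (x <# K)))"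
    proof (rule card_UN_disjoint[OF finC])
      show "\<forall>A\<in>C. finite (A \<inter> (x <# K))"
        using finite_subset[OF sub fin] by (metis Union_upper finite_Int finite_subset)
      show "\<forall>A\<in>C. \<forall>B\<in>C. A \<noteq> B \<longrightarrow> (A \<inter> (x <# K)) \<inter> (B \<inter> (x <# K)) = {}"
        using C lcos_disjoint[OF HK(1)] by blast
    qed
    also have "\<dots> = (\<Sum>A\<in>C. card (H \<inter> K))"
    proof (rule sum.cong[OF refl])
      fix A assume "A \<in> C"
      then obtain g where "g \<in> carrier G" "A = g <# H"
        using C by (auto simp: LCOSETS_def)
      then show "card (A \<inter> (x <# K)) = card (H \<inter> K)"
        using card_Int_l_cosets[OF HK] True by simp
    qed
    finally show ?thesis
      using True fin HK sub by (simp add: count_Delta_subgroup mult_carrier_def)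
  next
    case False
    \<comment> \<open>Outside the carrier both counts are zero, since quotients of group elements
      stay in the group.\<close>
    have "x \<notin># Delta G (\<Union>C) K"
    proof
      assume "x \<in># Delta G (\<Union>C) K"
      then obtain p where "p \<in># mset_set (\<Union>C \<times> K)" "x = (case p of (a, b) \<Rightarrow> a \<otimes> inv b)"
        by (auto simp: Delta_def)
      \<comment> \<open>For an infinite product \<open>mset_set\<close> would be empty and could not
        contain \<open>p\<close>.\<close>
      then have "\<exists>a b. a \<in> \<Union>C \<and> b \<in> K \<and> x = a \<otimes> inv b"
        by (cases "finite (\<Union>C \<times> K)") auto
      then show False
        using False sub subgroup.mem_carrier[OF HK(2)] by blast
    qed
    then show ?thesis
      using False by (simp add: mult_carrier_def not_in_iff)
  qed
qed

text \<open>The reason is \<open>inv (a \<otimes> inv b) = b \<otimes> inv a\<close>, applied to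
  each pair.\<close>

lemma Delta_swap:
  assumes "A \<subseteq> carrier G" "B \<subseteq> carrier G"
  shows "Delta G B A = image_mset (\<lambda>x. inv x) (Delta G A B)"
proof (cases "finite (A \<times> B)")
  case True
  have "mset_set (B \<times> A) = image_mset prod.swap (mset_set (A \<times> B))"
    by (simp add: image_mset_mset_set product_swap)
  then have "Delta G B A = image_mset (\<lambda>(a, b). b \<otimes> inv a) (mset_set (A \<times> B))"
    by (simp add: Delta_def multiset.map_comp comp_def case_prod_unfold)
  also have "\<dots> = image_mset (\<lambda>p. inv (case p of (a, b) \<Rightarrow> a \<otimes> inv b)) (mset_set (A \<times> B))"
  proof (rule image_mset_cong)
    fix p assume "p \<in># mset_set (A \<times> B)"
    then have "fst p \<in> carrier G" "snd p \<in> carrier G"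
      using True assms by auto
    then show "(case p of (a, b) \<Rightarrow> b \<otimes> inv a) = inv (case p of (a, b) \<Rightarrow> a \<otimes> inv b)"
      by (simp add: case_prod_beta inv_mult_group)
  qed
  finally show ?thesis
    by (simp add: Delta_def multiset.map_comp comp_def)
next
  case False
  \<comment> \<open>With infinitely many pairs, both sides are empty by the default value of
    \<open>mset_set\<close>.\<close>
  then have "infinite (B \<times> A)"
    by (metis finite_imageI product_swap)
  then show ?thesis
    using False by (simp add: Delta_def)
qed

lemma image_inv_mult_carrier: "image_mset (\<lambda>x. inv x) (mult_carrier l G) = mult_carrier l G"
proof -
  \<comment> \<open>Inversion is an involution, so it permutes the carrier and preserves every
    constant multiplicity.\<close>
  have bij: "bij_betw (m_inv G) (carrier G) (carrier G)"
    by (rule bij_betw_byWitness[where f' = "m_inv G"]) auto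
  have "image_mset (m_inv G) (mset_set (carrier G)) = mset_set (carrier G)"
    by (simp add: image_mset_mset_set[OF bij_betw_imp_inj_on[OF bij]] bij_betw_imp_surj_on[OF bij])
  then show ?thesis
    by (induction l) (simp_all add: mult_carrier_def)
qed

text \<open>This transfers results such as \<open>Delta_Union_lcosets\<close>, where the subgroup is
  the second argument, to the opposite order.\<close>

lemma Delta_eq_mult_carrier_commute:
  assumes "A \<subseteq> carrier G" "B \<subseteq> carrier G" "Delta G A B = mult_carrier l G"
  shows "Delta G B A = mult_carrier l G"
  by (metis assms Delta_swap image_inv_mult_carrier)

text \<open>This is the case of a single coset, \<open>H\<close> itself.\<close>

lemma Delta_subgroups:
  assumes "finite (carrier G)" "subgroup H G" "subgroup K G" "carrier G = H <#> K"
  shows "Delta G H K = mult_carrier (card (H \<inter> K)) G"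
proof -
  have "\<one> <# H = H"
    using assms(2) by (simp add: lcos_mult_one subgroup.subset)
  then have "{H} \<subseteq> lcosets H"
    by (auto simp: LCOSETS_def)
  then show ?thesis
    using Delta_Union_lcosets[OF assms, of "{H}"] by simp
qed

lemma card_Union_lcosets:
  assumes "finite (carrier G)" "subgroup H G" "C \<subseteq> lcosets H"
  shows "card (\<Union>C) = card C * card H"
proof -
  have "finite (\<Union>C)"
    using assms lcosets_part_G by (metis Union_mono finite_subset)
  moreover have "card A = card H" if "A \<in> C" for A
    using assms that l_card_cosets_equal subgroup.subset by (metis subsetD)
  moreover have "A \<inter> B = {}" if "A \<in> C" "B \<in> C" "A \<noteq> B" for A B
    using assms that lcos_disjoint by blast
  ultimately show ?thesis
    using card_partition[of C "card H"] finite_UnionD[of C] by (simp add: mult.commute)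
qed

text \<open>The formula for \<open>l i j\<close> comes for free: comparing sizes in the
  \<open>Delta\<close> equation gives \<open>k i * k j\<close> pairs on one side and
  \<open>l i j\<close> copies of the group on the other.\<close>

lemma nondisjoint_GPSEDF_withI:
  assumes fin: "finite (carrier G)"
    and sub: "\<And>i. i \<in> {1..m} \<Longrightarrow> A i \<subseteq> carrier G"
    and card: "\<And>i. i \<in> {1..m} \<Longrightarrow> card (A i) = k i"
    and Delta: "\<And>i j. i \<in> {1..m} \<Longrightarrow> j \<in> {1..m} \<Longrightarrow> i \<noteq> j \<Longrightarrow>
      Delta G (A i) (A j) = mult_carrier (l i j) G"
  shows "nondisjoint_GPSEDF_with G (order G) m k l A"
proof -
  have "real (l i j) = real (k i) * real (k j) / real (order G)"
    if ij: "i \<in> {1..m}" "j \<in> {1..m}" "i \<noteq> j" for i j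
  proof -
    have "size (Delta G (A i) (A j)) = k i * k j"
      using ij card by (simp add: Delta_def card_cartesian_product)
    moreover have "size (mult_carrier (l i j) G) = l i j * order G"
      by (simp add: mult_carrier_def order_def)
    ultimately have "k i * k j = l i j * order G"
      using Delta[OF ij] by simp
    then have "real (k i) * real (k j) = real (l i j) * real (order G)"
      by (metis of_nat_mult)
    moreover have "order G > 0"
      using fin by (simp add: order_gt_0_iff_finite)
    ultimately show ?thesis
      by (simp add: field_simps)
  qed
  then show ?thesis
    using assms is_group by (simp add: nondisjoint_GPSEDF_with_def)
qed

end

theorem theorem4p3:
  fixes G :: "('a, 'b) monoid_scheme" and H :: "nat \<Rightarrow> 'a set" and m :: nat
  assumes "group G" and "finite (carrier G)"
    and "\<And>i. i \<in> {1..m} \<Longrightarrow> subgroup (H i) G"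
    and "inj_on H {1..m}"
    and "\<And>i j. i \<in> {1..m} \<Longrightarrow> j \<in> {1..m} \<Longrightarrow> i \<noteq> j \<Longrightarrow> carrier G = H i <#>\<^bsub>G\<^esub> H j"
  shows "nondisjoint_GPSEDF_with G (order G) m (\<lambda>i. card (H i)) (\<lambda>i j. card (H i \<inter> H j)) H
    \<and> (\<forall>i\<in>{1..m}. \<forall>\<mu> C. C \<subseteq> lcosets\<^bsub>G\<^esub> (H i) \<and> card C = \<mu> \<longrightarrow>
          nondisjoint_GPSEDF G (order G) m
            ((\<lambda>j. card (H j))(i := \<mu> * card (H i))) (H(i := \<Union>C)))"
proof (intro conjI ballI allI impI)
  interpret group G by fact
  have sub: "H i \<subseteq> carrier G" if "i \<in> {1..m}" for i
    using assms(3)[OF that] by (rule subgroup.subset)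
  have Delta: "Delta G (H i) (H j) = mult_carrier (card (H i \<inter> H j)) G"
    if "i \<in> {1..m}" "j \<in> {1..m}" "i \<noteq> j" for i j
    using that assms by (intro Delta_subgroups) auto
  show "nondisjoint_GPSEDF_with G (order G) m (\<lambda>i. card (H i)) (\<lambda>i j. card (H i \<inter> H j)) H"
    using assms(2) sub Delta by (intro nondisjoint_GPSEDF_withI) auto
  fix i \<mu> C
  assume i: "i \<in> {1..m}" and C: "C \<subseteq> lcosets\<^bsub>G\<^esub> (H i) \<and> card C = \<mu>"
  have subC: "\<Union>C \<subseteq> carrier G"
    using C lcosets_part_G[OF assms(3)[OF i]] by blast
  have cardC: "card (\<Union>C) = \<mu> * card (H i)"
    using C card_Union_lcosets[OF assms(2) assms(3)[OF i]] by blast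
  have Delta_left: "Delta G (\<Union>C) (H j) = mult_carrier (\<mu> * card (H i \<inter> H j)) G"
    if "j \<in> {1..m}" "j \<noteq> i" for j
    using Delta_Union_lcosets[OF assms(2) assms(3)[OF i] assms(3)[OF that(1)] assms(5)[OF i that(1)]]
      that C by metis
  \<comment> \<open>Now the union of cosets is the second argument, so the previous fact is carried
    over by inverting quotients.\<close>
  have Delta_right: "Delta G (H j) (\<Union>C) = mult_carrier (\<mu> * card (H i \<inter> H j)) G"
    if "j \<in> {1..m}" "j \<noteq> i" for j
    using that subC sub Delta_left by (intro Delta_eq_mult_carrier_commute[of "\<Union>C"]) auto
  \<comment> \<open>Two distinct indices include \<open>i\<close> at most once, so a multiplicity
    gains at most one factor \<open>\<mu>\<close>; the diagonal values are irrelevant.\<close>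
  let ?l = "\<lambda>p q. (if p = i \<or> q = i then \<mu> else 1) * card (H p \<inter> H q)"
  have "nondisjoint_GPSEDF_with G (order G) m
      ((\<lambda>j. card (H j))(i := \<mu> * card (H i))) ?l (H(i := \<Union>C))"
    \<comment> \<open>The cases are: neither index is \<open>i\<close>, the first is, or the second
      is. In the last one the intersection appears with its sides exchanged.\<close>
    using assms(2) sub subC cardC Delta Delta_left Delta_right
    by (intro nondisjoint_GPSEDF_withI) (auto simp: Int_commute)
  then show "nondisjoint_GPSEDF G (order G) m
      ((\<lambda>j. card (H j))(i := \<mu> * card (H i))) (H(i := \<Union>C))"
    unfolding nondisjoint_GPSEDF_def by blast
qed

end
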